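(* For any strong tournament $T$ of order $n\ge 2$, we have $\rho(T)=\pi(T)$ if and only if $T$ is a strong regular tournament.
   Context: All digraphs are finite, without loops or parallel arcs. A tournament is an orientation of a complete graph (exactly one of the two possible arcs between each pair of distinct vertices). A digraph $D$ is strong if for every pair $u,v$ of vertices there are directed paths from $u$ to $v$ and from $v$ to $u$. A tournament on $n$ vertices is regular if $d^+(u)=d^-(u)=\frac{n-1}{2}$ for every vertex $u$. For a strong digraph $D$ of order $n\ge 2$, $d(u,v)$ is the length of a shortest directed path from $u$ to $v$; $\sigma(u)=\sum_{v\in V(D)}d(u,v)$; $\bar\sigma(u)=\frac{\sigma(u)}{n-1}$; the proximity is $\pi(D)=\min\{\bar\sigma(u)\mid u\in V(D)\}$ and the remoteness is $\rho(D)=\max\{\bar\sigma(u)\mid u\in V(D)\}$. *)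

theory Defs
  imports Complex_Main "Graph_Theory.Graph_Theory"
begin

text \<open>
  The locale \<open>digraph\<close> of the AFP entry Graph_Theory describes finite digraphs without
  loops and parallel arcs; \<open>strongly_connected\<close> is the property of being strong.
\<close>

definition tournament :: "('a, 'b) pre_digraph \<Rightarrow> bool" where
  "tournament T \<longleftrightarrow> digraph T \<and>
     (\<forall>u \<in> verts T. \<forall>v \<in> verts T. u \<noteq> v \<longrightarrow> (u \<rightarrow>\<^bsub>T\<^esub> v) \<noteq> (v \<rightarrow>\<^bsub>T\<^esub> u))"

definition regular_tournament :: "('a, 'b) pre_digraph \<Rightarrow> bool" where
  "regular_tournament T \<longleftrightarrow> tournament T \<and>
     (\<forall>u \<in> verts T. real (out_degree T u) = (real (card (verts T)) - 1) / 2 \<and>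
                   real (in_degree T u) = (real (card (verts T)) - 1) / 2)"

text \<open>
  An \<open>apath\<close> is a list of arcs whose vertices are distinct, so its length is the number of
  arcs. The empty list is a path from a vertex to itself. The value of the following function
  is unspecified if there is no path from \<open>u\<close> to \<open>v\<close>; this does not occur in a strong digraph.
\<close>

definition distance :: "('a, 'b) pre_digraph \<Rightarrow> 'a \<Rightarrow> 'a \<Rightarrow> nat" where
  "distance D u v = (LEAST k. \<exists>p. pre_digraph.apath D u p v \<and> length p = k)"

definition total_distance :: "('a, 'b) pre_digraph \<Rightarrow> 'a \<Rightarrow> nat" where
  "total_distance D u = (\<Sum>v \<in> verts D. distance D u v)"

definition average_distance :: "('a, 'b) pre_digraph \<Rightarrow> 'a \<Rightarrow> real" where
  "average_distance D u = real (total_distance D u) / (real (card (verts D)) - 1)"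

definition proximity :: "('a, 'b) pre_digraph \<Rightarrow> real" where
  "proximity D = Min (average_distance D ` verts D)"

definition remoteness :: "('a, 'b) pre_digraph \<Rightarrow> real" where
  "remoteness D = Max (average_distance D ` verts D)"

text \<open>
  The distance agrees with the library's weighted distance \<open>\<mu>\<close> for unit arc weights. The latter
  is an extended real and an infimum over all walks.
\<close>

lemma (in wf_digraph) distance_eq_unit_weight_dist:
  assumes "u \<rightarrow>\<^sup>* v"
  shows "\<mu> (\<lambda>_. 1) u v = ereal (real (distance G u v))"
proof -
  have cost: "awalk_cost (\<lambda>_. 1) p = real (length p)" for p :: "'b list"
    by (induct p) (auto simp: awalk_cost_def)
  from assms obtain q where "apath u q v"
    using reachable_apath by blast
  then have ex: "\<exists>k p. apath u p v \<and> length p = k"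
    by blast
  obtain p where p: "apath u p v" "length p = distance G u v"
    using LeastI_ex[OF ex] unfolding distance_def by blast
  have le: "distance G u v \<le> length w" if w: "awalk u w v" for w
  proof -
    have "distance G u v \<le> length (awalk_to_apath w)"
      unfolding distance_def by (rule Least_le) (use apath_awalk_to_apath[OF w] in blast)
    also have "\<dots> \<le> length w"
      using w
    proof (induct rule: awalk_to_apath_induct)
      case (path p)
      then have "awalk_to_apath p = p"
        by (auto simp: awalk_to_apath.simps)
      then show ?case by simp
    next
      case (decomp p q r s)
      then have "p = q @ r @ s"
        by (auto elim: awalk_cyc_decompE)
      then show ?case using decomp step_awalk_to_apath[of u p v q r s] by simp
    qed
    finally show ?thesis .
  qed
  show ?thesis
    unfolding \<mu>_def cost
  proof (rule INF_eqI)
    show "ereal (real (distance G u v)) \<le> ereal (real (length w))" if "w \<in> {p. awalk u p v}" for w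
      using le that by simp
    show "y \<le> ereal (real (distance G u v))"
      if "\<And>w. w \<in> {p. awalk u p v} \<Longrightarrow> y \<le> ereal (real (length w))" for y
      using that[of p] p by (auto intro: awalkI_apath)
  qed
qed

end

theory Submission
  imports Defs
begin

text \<open>
  In a strong tournament on \<open>n\<close> vertices a vertex \<open>u\<close> has distance 1 to its out-neighbours and distance
  at least 2 to the remaining \<open>n - 1 - d\<^sup>+(u)\<close> vertices. Hence \<open>\<sigma>(u) \<ge> 2(n - 1) - d\<^sup>+(u)\<close>, with
  equality if and only if every vertex is within distance 2 of \<open>u\<close>. By Landau's observation
  (\<open>max_out_degree_two_step\<close>) equality does hold for a vertex of maximum out-degree.

  If \<open>\<sigma>\<close> is constant, compare an arbitrary vertex \<open>v\<close> with a vertex \<open>u\<close> of maximum out-degree: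
  \<open>2(n - 1) - d\<^sup>+(u) = \<sigma>(u) = \<sigma>(v) \<ge> 2(n - 1) - d\<^sup>+(v)\<close>, so \<open>d\<^sup>+(v)\<close> is maximum as well. All
  out-degrees then agree, and counting the arcs by their tails and by their heads shows that
  they equal the common in-degree. Conversely, in a regular tournament every vertex has maximum
  out-degree, so \<open>\<sigma>\<close> takes the value \<open>2(n - 1) - (n - 1) / 2\<close> everywhere.
\<close>

section \<open>Degrees in digraphs\<close>

lemma (in digraph) out_degree_eq_card_out_neighbours:
  "out_degree G u = card {v \<in> verts G. u \<rightarrow> v}"
proof -
  have "bij_betw (head G) (out_arcs G u) {v \<in> verts G. u \<rightarrow> v}"
    unfolding bij_betw_def
  proof
    show "inj_on (head G) (out_arcs G u)"
      using no_multi_arcs by (auto intro!: inj_onI simp: arc_to_ends_def)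
    show "head G ` out_arcs G u = {v \<in> verts G. u \<rightarrow> v}"
      by (force simp: arcs_ends_def arc_to_ends_def)
  qed
  then show ?thesis
    unfolding out_degree_def by (rule bij_betw_same_card)
qed

lemma (in digraph) in_degree_eq_card_in_neighbours:
  "in_degree G v = card {u \<in> verts G. u \<rightarrow> v}"
proof -
  have "bij_betw (tail G) (in_arcs G v) {u \<in> verts G. u \<rightarrow> v}"
    unfolding bij_betw_def
  proof
    show "inj_on (tail G) (in_arcs G v)"
      using no_multi_arcs by (auto intro!: inj_onI simp: arc_to_ends_def)
    show "tail G ` in_arcs G v = {u \<in> verts G. u \<rightarrow> v}"
      by (force simp: arcs_ends_def arc_to_ends_def)
  qed
  then show ?thesis
    unfolding in_degree_def by (rule bij_betw_same_card)
qed

lemma (in digraph) sum_out_degree_eq_sum_in_degree: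
  "(\<Sum>u \<in> verts G. out_degree G u) = (\<Sum>v \<in> verts G. in_degree G v)"
  unfolding out_degree_eq_card_out_neighbours
  by (rule sum_multicount_gen) (auto simp: in_degree_eq_card_in_neighbours)

section \<open>Short distances\<close>

lemma (in wf_digraph) distance_le_apath:
  "apath u p v \<Longrightarrow> distance G u v \<le> length p"
  unfolding distance_def by (rule Least_le) blast

lemma (in wf_digraph) shortest_apath_exists:
  assumes "u \<rightarrow>\<^sup>* v"
  obtains p where "apath u p v" "length p = distance G u v"
proof -
  have "\<exists>k p. apath u p v \<and> length p = k"
    using assms reachable_apath by blast
  from LeastI_ex[OF this] that show thesis
    unfolding distance_def by blast
qed

lemma (in wf_digraph) distance_self:
  "u \<in> verts G \<Longrightarrow> distance G u u = 0"
  using distance_le_apath[of u "[]" u] by (simp add: apath_Nil_iff)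

lemma (in wf_digraph) distance_pos:
  assumes "u \<rightarrow>\<^sup>* v" "u \<noteq> v"
  shows "1 \<le> distance G u v"
  using assms by (metis shortest_apath_exists apath_Nil_iff length_0_conv less_one not_le)

lemma (in wf_digraph) distance_ge_2_if_not_dominates:
  assumes "u \<rightarrow>\<^sup>* v" "u \<noteq> v" "\<not> u \<rightarrow> v"
  shows "2 \<le> distance G u v"
proof (rule ccontr)
  assume "\<not> 2 \<le> distance G u v"
  with distance_pos[OF assms(1,2)] have "distance G u v = Suc 0"
    by simp
  with assms(1) obtain p where "apath u p v" "length p = Suc 0"
    by (metis shortest_apath_exists)
  then have "u \<rightarrow> v"
    by (auto simp: length_Suc_conv apath_simps intro: in_arcs_imp_in_arcs_ends)
  with assms(3) show False ..
qed

lemma (in loopfree_digraph) distance_le_1_if_dominates: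
  assumes "u \<rightarrow> v"
  shows "distance G u v \<le> 1"
proof -
  obtain e where e: "e \<in> arcs G" "tail G e = u" "head G e = v"
    using assms by (auto simp: arcs_ends_def arc_to_ends_def)
  then have "apath u [e] v"
    using no_loops[of e] by (auto simp: apath_simps)
  from distance_le_apath[OF this] show ?thesis
    by simp
qed

lemma (in loopfree_digraph) distance_le_2_if_two_step:
  assumes "u \<rightarrow> w" "w \<rightarrow> v" "u \<noteq> v"
  shows "distance G u v \<le> 2"
proof -
  obtain e f where "e \<in> arcs G" "tail G e = u" "head G e = w"
    "f \<in> arcs G" "tail G f = w" "head G f = v"
    using assms(1,2) by (auto simp: arcs_ends_def arc_to_ends_def)
  then have "apath u [e, f] v"
    using no_loops[of e] no_loops[of f] assms(3) by (auto simp: apath_simps)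
  from distance_le_apath[OF this] show ?thesis
    by simp
qed

section \<open>Total distance and out-degree in tournaments\<close>

text \<open>
  A vertex \<open>v\<close> that \<open>u\<close> does not reach in two steps dominates \<open>u\<close> and every out-neighbour of
  \<open>u\<close>, so it has a larger out-degree than \<open>u\<close>.
\<close>

lemma max_out_degree_two_step:
  assumes T: "tournament T" and u: "u \<in> verts T"
    and max: "\<forall>v \<in> verts T. out_degree T v \<le> out_degree T u"
    and v: "v \<in> verts T" "u \<noteq> v" "\<not> u \<rightarrow>\<^bsub>T\<^esub> v"
  obtains w where "u \<rightarrow>\<^bsub>T\<^esub> w" "w \<rightarrow>\<^bsub>T\<^esub> v"
proof (rule ccontr)
  assume "\<not> thesis"
  with that have no_step: "\<forall>w. u \<rightarrow>\<^bsub>T\<^esub> w \<longrightarrow> \<not> w \<rightarrow>\<^bsub>T\<^esub> v"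
    by blast
  interpret digraph T
    using T by (simp add: tournament_def)
  let ?N = "\<lambda>x. {w \<in> verts T. x \<rightarrow>\<^bsub>T\<^esub> w}"
  have arc: "(x \<rightarrow>\<^bsub>T\<^esub> y) \<noteq> (y \<rightarrow>\<^bsub>T\<^esub> x)" if "x \<in> verts T" "y \<in> verts T" "x \<noteq> y" for x y
    using T that unfolding tournament_def by blast
  have "u \<notin> ?N u"
    using adj_not_same by blast
  then have "Suc (card (?N u)) = card (insert u (?N u))"
    by simp
  also have "\<dots> \<le> card (?N v)"
  proof (rule card_mono)
    show "insert u (?N u) \<subseteq> ?N v"
      using arc v u no_step by blast
  qed simp
  finally have "out_degree T u < out_degree T v"
    by (simp add: out_degree_eq_card_out_neighbours)
  with max v(1) show False
    by (simp add: leD)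
qed

text \<open>
  Adding the out-degree evens out the contributions of the vertices: each \<open>v \<noteq> u\<close> contributes
  exactly 2 to the sum if \<open>v\<close> is within distance 2 of \<open>u\<close>, and more otherwise. Both bounds on
  \<open>\<sigma>(u) + d\<^sup>+(u)\<close> are therefore proved one summand at a time, without subtraction on \<open>nat\<close>.
\<close>

lemma total_distance_plus_out_degree:
  assumes "digraph T" and u: "u \<in> verts T"
  shows "total_distance T u + out_degree T u =
    (\<Sum>v \<in> verts T - {u}. distance T u v + (if u \<rightarrow>\<^bsub>T\<^esub> v then 1 else 0))"
proof -
  interpret digraph T by fact
  have "{v \<in> verts T. u \<rightarrow>\<^bsub>T\<^esub> v} = {v \<in> verts T - {u}. u \<rightarrow>\<^bsub>T\<^esub> v}"
    using adj_not_same by blast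
  then have "out_degree T u = (\<Sum>v \<in> verts T - {u}. if u \<rightarrow>\<^bsub>T\<^esub> v then 1 else 0)"
    by (simp add: out_degree_eq_card_out_neighbours sum.If_cases Int_def)
  moreover have "total_distance T u = (\<Sum>v \<in> verts T - {u}. distance T u v)"
    unfolding total_distance_def using u by (simp add: sum.remove distance_self)
  ultimately show ?thesis
    by (simp add: sum.distrib)
qed

lemma total_distance_lower_bound:
  assumes "digraph T" "strongly_connected T" and u: "u \<in> verts T"
  shows "2 * (card (verts T) - 1) \<le> total_distance T u + out_degree T u"
proof -
  interpret digraph T by fact
  have "2 \<le> distance T u v + (if u \<rightarrow>\<^bsub>T\<^esub> v then 1 else 0)" if "v \<in> verts T - {u}" for v
  proof -
    have "u \<rightarrow>\<^sup>*\<^bsub>T\<^esub> v" "u \<noteq> v"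
      using assms that by (auto simp: strongly_connected_def)
    then show ?thesis
      using distance_pos[of u v] distance_ge_2_if_not_dominates[of u v] by auto
  qed
  then have "(\<Sum>v \<in> verts T - {u}. 2) \<le>
    (\<Sum>v \<in> verts T - {u}. distance T u v + (if u \<rightarrow>\<^bsub>T\<^esub> v then 1 else 0))"
    by (rule sum_mono)
  then show ?thesis
    using u by (simp add: total_distance_plus_out_degree assms(1) mult.commute)
qed

lemma total_distance_upper_bound_if_max_out_degree:
  assumes T: "tournament T" and u: "u \<in> verts T"
    and max: "\<forall>v \<in> verts T. out_degree T v \<le> out_degree T u"
  shows "total_distance T u + out_degree T u \<le> 2 * (card (verts T) - 1)"
proof -
  interpret digraph T
    using T by (simp add: tournament_def)
  have "distance T u v + (if u \<rightarrow>\<^bsub>T\<^esub> v then 1 else 0) \<le> 2" if v: "v \<in> verts T - {u}" for v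
  proof (cases "u \<rightarrow>\<^bsub>T\<^esub> v")
    case True
    then show ?thesis
      using distance_le_1_if_dominates by force
  next
    case False
    with v obtain w where "u \<rightarrow>\<^bsub>T\<^esub> w" "w \<rightarrow>\<^bsub>T\<^esub> v"
      using max_out_degree_two_step[OF T u max] by auto
    with False v show ?thesis
      using distance_le_2_if_two_step by auto
  qed
  then have "(\<Sum>v \<in> verts T - {u}. distance T u v + (if u \<rightarrow>\<^bsub>T\<^esub> v then 1 else 0)) \<le>
    (\<Sum>v \<in> verts T - {u}. 2)"
    by (rule sum_mono)
  then show ?thesis
    using u by (simp add: total_distance_plus_out_degree digraph_axioms mult.commute)
qed

section \<open>Regular tournaments\<close>

lemma out_degree_plus_in_degree_tournament:
  assumes T: "tournament T" and u: "u \<in> verts T"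
  shows "out_degree T u + in_degree T u + 1 = card (verts T)"
proof -
  interpret digraph T
    using T by (simp add: tournament_def)
  let ?O = "{v \<in> verts T. u \<rightarrow>\<^bsub>T\<^esub> v}" and ?I = "{v \<in> verts T. v \<rightarrow>\<^bsub>T\<^esub> u}"
  have arc: "(u \<rightarrow>\<^bsub>T\<^esub> v) \<noteq> (v \<rightarrow>\<^bsub>T\<^esub> u)" if "v \<in> verts T" "v \<noteq> u" for v
    using T u that unfolding tournament_def by blast
  have irrefl: "\<not> u \<rightarrow>\<^bsub>T\<^esub> u"
    using adj_not_same by blast
  have "?O \<inter> ?I = {}" "?O \<union> ?I = verts T - {u}"
    using arc irrefl by blast+
  then have "card ?O + card ?I = card (verts T - {u})"
    by (metis (no_types, lifting) card_Un_disjoint finite_Un finite_Diff finite_verts)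
  moreover have "card (verts T) > 0"
    using u by (auto simp: card_gt_0_iff)
  ultimately show ?thesis
    using u by (simp add: out_degree_eq_card_out_neighbours in_degree_eq_card_in_neighbours)
qed

text \<open>
  The in-degrees of a tournament with constant out-degree \<open>k\<close> are all \<open>n - 1 - k\<close>. Both
  degrees have the number of arcs as their sum, so \<open>k = n - 1 - k\<close>.
\<close>

lemma regular_tournament_iff_out_degree_const:
  assumes T: "tournament T"
  shows "regular_tournament T \<longleftrightarrow>
    (\<forall>u \<in> verts T. \<forall>v \<in> verts T. out_degree T u = out_degree T v)"
proof
  assume "regular_tournament T"
  then show "\<forall>u \<in> verts T. \<forall>v \<in> verts T. out_degree T u = out_degree T v"
    unfolding regular_tournament_def by (metis of_nat_eq_iff)
next
  assume const: "\<forall>u \<in> verts T. \<forall>v \<in> verts T. out_degree T u = out_degree T v"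
  interpret digraph T
    using T by (simp add: tournament_def)
  have deg: "out_degree T u + in_degree T u + 1 = card (verts T)" if "u \<in> verts T" for u
    using out_degree_plus_in_degree_tournament[OF T that] .
  have eq: "out_degree T u = in_degree T u" if u: "u \<in> verts T" for u
  proof -
    have out: "out_degree T v = out_degree T u" and in': "in_degree T v = in_degree T u"
      if "v \<in> verts T" for v
    proof -
      show "out_degree T v = out_degree T u"
        using const u that by blast
      then show "in_degree T v = in_degree T u"
        using deg[OF u] deg[OF that] by linarith
    qed
    have "card (verts T) * out_degree T u = card (verts T) * in_degree T u"
      using sum_out_degree_eq_sum_in_degree by (simp add: out in')
    moreover have "card (verts T) \<noteq> 0"
      using u by auto
    ultimately show ?thesis
      by simp
  qed
  have "real (out_degree T u) = (real (card (verts T)) - 1) / 2 \<and>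
    real (in_degree T u) = (real (card (verts T)) - 1) / 2" if "u \<in> verts T" for u
    using deg[OF that] eq[OF that] by (simp flip: deg[OF that])
  with T show "regular_tournament T"
    by (simp add: regular_tournament_def)
qed

section \<open>Remoteness and proximity\<close>

text \<open>
  The largest and the smallest element of a finite set agree precisely if the set has no two
  distinct elements, and averages may be compared through totals since \<open>n - 1 \<noteq> 0\<close>.
\<close>

lemma remoteness_eq_proximity_iff_total_distance_const:
  assumes "card (verts D) \<ge> 2"
  shows "remoteness D = proximity D \<longleftrightarrow>
    (\<forall>u \<in> verts D. \<forall>v \<in> verts D. total_distance D u = total_distance D v)"
proof -
  have fin: "finite (verts D)" and ne: "verts D \<noteq> {}"
    using assms by (auto intro: card_ge_0_finite)
  let ?S = "average_distance D ` verts D"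
  have "Max ?S = Min ?S \<longleftrightarrow> (\<forall>x \<in> ?S. \<forall>y \<in> ?S. x = y)"
  proof
    assume "Max ?S = Min ?S"
    then show "\<forall>x \<in> ?S. \<forall>y \<in> ?S. x = y"
      using fin by (metis Max_ge Min_le finite_imageI order_antisym)
  next
    assume "\<forall>x \<in> ?S. \<forall>y \<in> ?S. x = y"
    then show "Max ?S = Min ?S"
      using fin ne by (meson Max_in Min_in finite_imageI image_is_empty)
  qed
  also have "\<dots> \<longleftrightarrow> (\<forall>u \<in> verts D. \<forall>v \<in> verts D. total_distance D u = total_distance D v)"
    using assms by (auto simp: average_distance_def)
  finally show ?thesis
    by (simp add: remoteness_def proximity_def)
qed

theorem theorem3p2:
  fixes T :: "('a, 'b) pre_digraph"
  assumes "tournament T"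
    and "strongly_connected T"
    and "card (verts T) \<ge> 2"
  shows "remoteness T = proximity T \<longleftrightarrow> strongly_connected T \<and> regular_tournament T"
proof -
  interpret digraph T
    using assms(1) by (simp add: tournament_def)
  note lower = total_distance_lower_bound[OF digraph_axioms assms(2)]
  note upper = total_distance_upper_bound_if_max_out_degree[OF assms(1)]
  have "(\<forall>u \<in> verts T. \<forall>v \<in> verts T. total_distance T u = total_distance T v) \<longleftrightarrow>
    (\<forall>u \<in> verts T. \<forall>v \<in> verts T. out_degree T u = out_degree T v)"
  proof
    assume const: "\<forall>u \<in> verts T. \<forall>v \<in> verts T. total_distance T u = total_distance T v"
    have "verts T \<noteq> {}"
      using assms(2) by (simp add: strongly_connected_def)
    then have "Max (out_degree T ` verts T) \<in> out_degree T ` verts T"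
      by simp
    then obtain u where u: "u \<in> verts T" "out_degree T u = Max (out_degree T ` verts T)"
      by auto
    then have max: "\<forall>v \<in> verts T. out_degree T v \<le> out_degree T u"
      by simp
    have "out_degree T v = out_degree T u" if v: "v \<in> verts T" for v
    proof -
      have "total_distance T v = total_distance T u"
        using const u(1) v by blast
      then have "out_degree T u \<le> out_degree T v"
        using upper[OF u(1) max] lower[OF v] by linarith
      with max v show ?thesis
        by (simp add: order_antisym)
    qed
    then show "\<forall>u \<in> verts T. \<forall>v \<in> verts T. out_degree T u = out_degree T v"
      by simp
  next
    \<comment> \<open>Equal out-degrees are all maximum, so the upper bound applies at every vertex.\<close>
    assume const: "\<forall>u \<in> verts T. \<forall>v \<in> verts T. out_degree T u = out_degree T v"
    have "total_distance T u + out_degree T u = 2 * (card (verts T) - 1)"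
      if u: "u \<in> verts T" for u
    proof (rule order_antisym)
      show "total_distance T u + out_degree T u \<le> 2 * (card (verts T) - 1)"
        using upper[OF u] const u by (metis order_refl)
    qed (rule lower[OF u])
    with const show "\<forall>u \<in> verts T. \<forall>v \<in> verts T. total_distance T u = total_distance T v"
      by (metis add_right_cancel)
  qed
  with assms show ?thesis
    by (simp add: remoteness_eq_proximity_iff_total_distance_const
        regular_tournament_iff_out_degree_const)
qed

end
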